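(* Let $U\in\mathbb{C}^{n\times n}$ be a scaled upper triangular matrix such that $U=I+U_s$, with $I$ the identity matrix of dimension $n$ and $U_s$ a strictly upper triangular matrix with elements satisfying $|u_{i,j}|\le 1$. For $\nu=\|U_s\|_F$, $$dep(U)\le\sqrt{(2\sqrt n+\nu)\,\nu}.$$
   Context: For $A\in\mathbb{C}^{n\times n}$, Henrici's departure from normality is $dep(A)=\sqrt{\|A\|_F^2-\|D\|_F^2}$, where $D\in\mathbb{C}^{n\times n}$ is the diagonal matrix containing the eigenvalues of $A$ (with multiplicity) and $\|\cdot\|_F$ is the Frobenius norm. "Scaled" means that rows and/or columns have been scaled so that the diagonal entries equal one and all other entries are at most one in absolute value. *)

theory Defs
  imports "HOL-Analysis.Analysis" "Jordan_Normal_Form.Char_Poly"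
begin

definition frobenius_norm :: "complex mat \<Rightarrow> real" where
  "frobenius_norm A = sqrt (\<Sum>i<dim_row A. \<Sum>j<dim_col A. (cmod (A $$ (i, j)))\<^sup>2)"

(* "With multiplicity" is algebraic multiplicity: the order of the root in char_poly A. *)
definition eigenvalue_diagonal :: "complex mat \<Rightarrow> complex mat \<Rightarrow> bool" where
  "eigenvalue_diagonal A D \<longleftrightarrow>
     D \<in> carrier_mat (dim_row A) (dim_row A) \<and> diagonal_mat D \<and>
     (\<forall>e. count (mset (diag_mat D)) e = Polynomial.order e (char_poly A))"

(* D is determined only up to the ordering of its diagonal; dep_eqI below shows that
   the value does not depend on the chosen D. *)
definition dep :: "complex mat \<Rightarrow> real" where
  "dep A = sqrt ((frobenius_norm A)\<^sup>2 -
                 (frobenius_norm (SOME D. eigenvalue_diagonal A D))\<^sup>2)"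

definition scaled :: "complex mat \<Rightarrow> bool" where
  "scaled A \<longleftrightarrow>
     (\<forall>i<dim_row A. \<forall>j<dim_col A. if i = j then A $$ (i, j) = 1 else cmod (A $$ (i, j)) \<le> 1)"

definition strictly_upper_triangular :: "complex mat \<Rightarrow> bool" where
  "strictly_upper_triangular A \<longleftrightarrow> (\<forall>i<dim_row A. \<forall>j<dim_col A. j \<le> i \<longrightarrow> A $$ (i, j) = 0)"

lemma frobenius_norm_diagonal:
  assumes "D \<in> carrier_mat n n" "diagonal_mat D"
  shows "(frobenius_norm D)\<^sup>2 = (\<Sum>d\<in>#mset (diag_mat D). (cmod d)\<^sup>2)"
proof -
  have "(frobenius_norm D)\<^sup>2 = (\<Sum>i<n. \<Sum>j<n. (cmod (D $$ (i, j)))\<^sup>2)"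
    using assms(1) by (simp add: frobenius_norm_def sum_nonneg)
  also have "\<dots> = (\<Sum>i<n. \<Sum>j<n. if j = i then (cmod (D $$ (i, i)))\<^sup>2 else 0)"
    using assms by (intro sum.cong refl) (auto simp: diagonal_mat_def)
  also have "\<dots> = (\<Sum>i<n. (cmod (D $$ (i, i)))\<^sup>2)"
    by simp
  also have "\<dots> = sum_list (map (\<lambda>d. (cmod d)\<^sup>2) (diag_mat D))"
    using assms(1)
    by (simp add: diag_mat_def comp_def interv_sum_list_conv_sum_set_nat atLeast0LessThan)
  also have "\<dots> = (\<Sum>d\<in>#mset (diag_mat D). (cmod d)\<^sup>2)"
    by (simp flip: sum_mset_sum_list)
  finally show ?thesis .
qed

lemma order_linear_factors:
  "Polynomial.order e (\<Prod>a\<leftarrow>as. [:- a, 1:]) = count (mset as) (e :: complex)"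
proof (induction as)
  case (Cons a as)
  have nz: "(\<Prod>a\<leftarrow>as. [:- a, 1:]) \<noteq> 0"
    by (auto simp: prod_list_zero_iff)
  have "Polynomial.order e [:- a, 1:] = (if a = e then 1 else 0)"
    using order_power_n_n[of e 1] by (auto simp: order_0I)
  with Cons nz show ?case
    by (simp add: order_mult del: mult_pCons_left)
qed simp

lemma eigenvalue_diagonal_exists:
  assumes "A \<in> carrier_mat n n"
  shows "\<exists>D. eigenvalue_diagonal A D"
proof -
  obtain as where as: "char_poly A = (\<Prod>a\<leftarrow>as. [:- a, 1:])" "length as = n"
    using char_poly_factorized[OF assms] by blast
  define D where "D = mat n n (\<lambda>(i, j). if i = j then as ! i else 0)"
  have "diag_mat D = as"
    using as(2) by (auto simp: D_def diag_mat_def intro: nth_equalityI)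
  moreover have "D \<in> carrier_mat n n" "diagonal_mat D"
    by (auto simp: D_def diagonal_mat_def)
  ultimately show ?thesis
    using assms as(1) by (auto simp: eigenvalue_diagonal_def order_linear_factors)
qed

lemma dep_eqI:
  assumes "eigenvalue_diagonal A D"
  shows "dep A = sqrt ((frobenius_norm A)\<^sup>2 - (frobenius_norm D)\<^sup>2)"
proof -
  let ?E = "SOME D. eigenvalue_diagonal A D"
  have E: "eigenvalue_diagonal A ?E"
    using assms by (rule someI)
  have "mset (diag_mat ?E) = mset (diag_mat D)"
    using E assms by (intro multiset_eqI) (simp add: eigenvalue_diagonal_def)
  moreover have "(frobenius_norm B)\<^sup>2 = (\<Sum>d\<in>#mset (diag_mat B). (cmod d)\<^sup>2)"
    if "eigenvalue_diagonal A B" for B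
    using that frobenius_norm_diagonal unfolding eigenvalue_diagonal_def by blast
  ultimately have "(frobenius_norm ?E)\<^sup>2 = (frobenius_norm D)\<^sup>2"
    using E assms by metis
  then show ?thesis
    by (simp add: dep_def)
qed

end

theory Submission
  imports Defs
begin

text \<open>
  The eigenvalues of a triangular matrix are its diagonal entries. Hence for
  \<open>T = D + N\<close> with \<open>D\<close> diagonal and \<open>N\<close> strictly upper triangular, \<open>D\<close> itself is an
  admissible diagonal matrix of eigenvalues. As \<open>D\<close> and \<open>N\<close> have disjoint supports,
  \<open>\<parallel>T\<parallel>\<^sup>2 = \<parallel>D\<parallel>\<^sup>2 + \<parallel>N\<parallel>\<^sup>2\<close> in the Frobenius norm, so the departure from
  normality of \<open>T\<close> is exactly \<open>\<parallel>N\<parallel>\<close> (lemma \<open>dep_diagonal_plus_strictly_upper\<close>).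

  For \<open>D = I\<close> this gives \<open>dep U = \<nu>\<close>, and the claimed bound follows from
  \<open>\<nu>\<^sup>2 \<le> 2 \<surd>n \<nu> + \<nu>\<^sup>2\<close>. The term \<open>2 \<surd>n \<nu>\<close> is what is lost if
  \<open>\<parallel>I + U\<^sub>s\<parallel>\<close> is instead estimated by the triangle inequality
  \<open>\<parallel>I + U\<^sub>s\<parallel> \<le> \<surd>n + \<nu>\<close>.
\<close>

lemma frobenius_norm_nonneg: "0 \<le> frobenius_norm A"
  by (simp add: frobenius_norm_def sum_nonneg)

lemma frobenius_norm_squared:
  assumes "A \<in> carrier_mat m n"
  shows "(frobenius_norm A)\<^sup>2 = (\<Sum>i<m. \<Sum>j<n. (cmod (A $$ (i, j)))\<^sup>2)"
  using assms by (simp add: frobenius_norm_def sum_nonneg)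

text \<open>
  Pythagoras: matrices with disjoint supports are orthogonal for the inner product
  that induces the Frobenius norm.
\<close>

lemma frobenius_norm_add_disjoint_support:
  assumes A: "A \<in> carrier_mat m n" and B: "B \<in> carrier_mat m n"
    and disj: "\<And>i j. i < m \<Longrightarrow> j < n \<Longrightarrow> A $$ (i, j) = 0 \<or> B $$ (i, j) = 0"
  shows "(frobenius_norm (A + B))\<^sup>2 = (frobenius_norm A)\<^sup>2 + (frobenius_norm B)\<^sup>2"
proof -
  have "(cmod ((A + B) $$ (i, j)))\<^sup>2 = (cmod (A $$ (i, j)))\<^sup>2 + (cmod (B $$ (i, j)))\<^sup>2"
    if "i < m" "j < n" for i j
    using A B disj[OF that] that by auto
  moreover have AB: "A + B \<in> carrier_mat m n"
    using B by simp
  ultimately show ?thesis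
    unfolding frobenius_norm_squared[OF A] frobenius_norm_squared[OF B]
      frobenius_norm_squared[OF AB]
    by (simp add: sum.distrib del: index_add_mat)
qed

lemma eigenvalue_diagonal_upper_triangular:
  assumes A: "A \<in> carrier_mat n n" and "upper_triangular A"
    and D: "D \<in> carrier_mat n n" "diagonal_mat D" and diag: "diag_mat D = diag_mat A"
  shows "eigenvalue_diagonal A D"
  using assms char_poly_upper_triangular[OF A]
  by (simp add: eigenvalue_diagonal_def order_linear_factors)

text \<open>
  The strictly upper triangular part carries the whole departure from normality,
  because subtracting the squared moduli of the eigenvalues removes precisely the
  contribution of the diagonal to the Frobenius norm.
\<close>

lemma dep_diagonal_plus_strictly_upper:
  assumes D: "D \<in> carrier_mat n n" "diagonal_mat D"
    and N: "N \<in> carrier_mat n n" "strictly_upper_triangular N"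
  shows "dep (D + N) = frobenius_norm N"
proof -
  have N0: "N $$ (i, j) = 0" if "i < n" "j \<le> i" for i j
    using N that by (auto simp: strictly_upper_triangular_def)
  have D0: "D $$ (i, j) = 0" if "i < n" "j < n" "i \<noteq> j" for i j
    using D that by (auto simp: diagonal_mat_def)
  have "upper_triangular (D + N)"
    using D(1) N(1) by (auto simp: upper_triangular_def D0 N0)
  moreover have "diag_mat D = diag_mat (D + N)"
    using D(1) N(1) by (auto simp: diag_mat_def N0)
  ultimately have "eigenvalue_diagonal (D + N) D"
    using D N(1) by (intro eigenvalue_diagonal_upper_triangular) auto
  then have "dep (D + N) = sqrt ((frobenius_norm (D + N))\<^sup>2 - (frobenius_norm D)\<^sup>2)"
    by (rule dep_eqI)
  moreover have "D $$ (i, j) = 0 \<or> N $$ (i, j) = 0" if "i < n" "j < n" for i j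
    using that D0 N0 by (cases "i = j") auto
  then have "(frobenius_norm (D + N))\<^sup>2 = (frobenius_norm D)\<^sup>2 + (frobenius_norm N)\<^sup>2"
    using D(1) N(1) by (intro frobenius_norm_add_disjoint_support)
  ultimately show ?thesis
    by (simp add: frobenius_norm_nonneg)
qed

theorem theorem5p3:
  fixes n :: nat and U Us :: "complex mat" and \<nu> :: real
  assumes "U \<in> carrier_mat n n" and "upper_triangular U" and "scaled U"
    and "Us \<in> carrier_mat n n" and "strictly_upper_triangular Us"
    and "U = 1\<^sub>m n + Us"
    and "\<forall>i<n. \<forall>j<n. cmod (Us $$ (i, j)) \<le> 1"
    and "\<nu> = frobenius_norm Us"
  shows "dep U \<le> sqrt ((2 * sqrt (real n) + \<nu>) * \<nu>)"
proof -
  have "diagonal_mat (1\<^sub>m n :: complex mat)"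
    by (auto simp: diagonal_mat_def)
  then have "dep U = \<nu>"
    using assms(4-6,8) dep_diagonal_plus_strictly_upper[of "1\<^sub>m n" n Us] by simp
  have "0 \<le> \<nu>"
    using assms(8) by (simp add: frobenius_norm_nonneg)
  then have "\<nu>\<^sup>2 \<le> (2 * sqrt (real n) + \<nu>) * \<nu>"
    by (simp add: power2_eq_square algebra_simps)
  then show ?thesis
    using \<open>dep U = \<nu>\<close> by (simp add: real_le_rsqrt)
qed

end
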